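(* Consider a graph-based Markov decision process with $n$ agents, influence graph $(\mathcal V,\mathcal E)$, and a joint policy $\pi$. Assume that the local rewards are bounded and that $\gamma\in(0,1)$. Let $\Gamma=\gamma\,\mathbb A D^{-1}\in\mathbb R^{n\times n}$. Then the series defining the diffusion value function $$V_D(S)=\mathbb E_\pi\Big[\sum_{t=0}^\infty \Gamma^{t+1}R^t\;\Big|\;S^0=S\Big]\in\mathbb R^n$$ converges for all states $S$, and $V_D(S)$ is bounded for all states $S$.
   Context: Graph-based Markov decision process (GMDP). Agents are indexed by $\mathcal V=\{1,\dots,n\}$. Agent $i$ has local state space $\mathcal S_i$ and action space $\mathcal A_i$; there is an additional space $\mathcal S_0$ of global/unobserved state variables. The joint spaces are $\mathcal S=\prod_{i\in\mathcal V\cup\{0\}}\mathcal S_i$ and $\mathcal A=\prod_{i\in\mathcal V}\mathcal A_i$ (measurable spaces; all functions and kernels are measurable). The influence graph $(\mathcal V,\mathcal E)$ is a directed graph with $(i,i)\in\mathcal E$ for all $i$. For a node $i$ let $N_i^{\mathrm{in}}=\{j:(j,i)\in\mathcal E\}$, and for $N\subseteq\mathcal V$ write $X_N=(X_j)_{j\in N}$. Rewards and transitions factorise as $$\mathcal R(S,A)=n^{-1}\sum_{i\in\mathcal V}\mathcal R_i(S_{N_i^{\mathrm{in}}},S_0;A_{N_i^{\mathrm{in}}}),\qquad T(S'|S,A)=T_0(S_0'|S_0)\prod_{i\in\mathcal V}T_i(S_i'|S_{N_i^{\mathrm{in}}},S_0;A_{N_i^{\mathrm{in}}}).$$ At time $t$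 the state is $S^t$, the joint action is $A^t$, and $S^{t+1}\sim T(\cdot|S^t,A^t)$. The local reward at node $i$ is $R_i^t=\mathcal R_i(S^t_{N_i^{\mathrm{in}}},S_0^t;A^t_{N_i^{\mathrm{in}}})\in\mathbb R$, and $R^t=(R_1^t,\dots,R_n^t)^\top$. A joint policy is $\pi=(\pi_1,\dots,\pi_n)$, where $\pi_i$ maps the local history $\tau_i^t=(S_i^{0:t},A_i^{0:t-1})$ to a distribution over $\mathcal A_i$; given the histories, agents draw their actions independently. $\mathbb E_\pi$ denotes expectation under the resulting process. $\mathbb A\in\{0,1\}^{n\times n}$ is the adjacency matrix of the influence graph ($\mathbb A_{ij}=1$ iff $(i,j)\in\mathcal E$), and $D$ is the diagonal in-degree matrix, $D_{ii}=\sum_j\mathbb A_{ji}$ (positive by self-connectedness). *)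

theory Defs
  imports "HOL-Probability.Probability"
begin

section \<open>Graph-based Markov decision processes\<close>

text \<open>
  The agents are the elements of a finite type \<^typ>\<open>'n\<close>, so \<open>n = CARD('n) \<ge> 1\<close>.
  Each agent has its own measurable spaces of local states and actions; these are carried by
  measures on common types \<^typ>\<open>'s\<close> and \<^typ>\<open>'a\<close>, of which only the
  \<open>\<sigma>\<close>-algebra is used (the values of the measures are irrelevant). A joint state is a pair
  \<open>((S\<^sub>i)\<^sub>i, S\<^sub>0)\<close>. Local rewards and local kernels receive the restriction of the joint
  state and of the joint action to the in-neighbourhood of the agent.
\<close>

record ('n, 'g, 's, 'a) gmdp =
  edges :: "('n \<times> 'n) set"
  global_space :: "'g measure"
  local_space :: "'n \<Rightarrow> 's measure"
  action_space :: "'n \<Rightarrow> 'a measure"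
  local_reward :: "'n \<Rightarrow> ('n \<Rightarrow> 's) \<times> 'g \<times> ('n \<Rightarrow> 'a) \<Rightarrow> real"
  global_kernel :: "'g \<Rightarrow> 'g measure"
  local_kernel :: "'n \<Rightarrow> ('n \<Rightarrow> 's) \<times> 'g \<times> ('n \<Rightarrow> 'a) \<Rightarrow> 's measure"

definition in_nbrs :: "('n, 'g, 's, 'a) gmdp \<Rightarrow> 'n \<Rightarrow> 'n set" where
  "in_nbrs G i = {j. (j, i) \<in> edges G}"

definition states :: "('n, 'g, 's, 'a) gmdp \<Rightarrow> (('n \<Rightarrow> 's) \<times> 'g) measure" where
  "states G = PiM UNIV (local_space G) \<Otimes>\<^sub>M global_space G"

definition actions :: "('n, 'g, 's, 'a) gmdp \<Rightarrow> ('n \<Rightarrow> 'a) measure" where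
  "actions G = PiM UNIV (action_space G)"

definition nbr_space :: "('n, 'g, 's, 'a) gmdp \<Rightarrow> 'n \<Rightarrow> (('n \<Rightarrow> 's) \<times> 'g \<times> ('n \<Rightarrow> 'a)) measure" where
  "nbr_space G i =
     PiM (in_nbrs G i) (local_space G) \<Otimes>\<^sub>M global_space G \<Otimes>\<^sub>M PiM (in_nbrs G i) (action_space G)"

definition nbr_view ::
  "('n, 'g, 's, 'a) gmdp \<Rightarrow> 'n \<Rightarrow> ('n \<Rightarrow> 's) \<times> 'g \<Rightarrow> ('n \<Rightarrow> 'a) \<Rightarrow> ('n \<Rightarrow> 's) \<times> 'g \<times> ('n \<Rightarrow> 'a)" where
  "nbr_view G i S A = (restrict (fst S) (in_nbrs G i), snd S, restrict A (in_nbrs G i))"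

definition is_gmdp :: "('n::finite, 'g, 's, 'a) gmdp \<Rightarrow> bool" where
  "is_gmdp G \<longleftrightarrow>
     (\<forall>i. (i, i) \<in> edges G) \<and>
     (\<forall>i. local_reward G i \<in> nbr_space G i \<rightarrow>\<^sub>M borel) \<and>
     global_kernel G \<in> global_space G \<rightarrow>\<^sub>M prob_algebra (global_space G) \<and>
     (\<forall>i. local_kernel G i \<in> nbr_space G i \<rightarrow>\<^sub>M prob_algebra (local_space G i))"

definition reward :: "('n::finite, 'g, 's, 'a) gmdp \<Rightarrow> ('n \<Rightarrow> 's) \<times> 'g \<Rightarrow> ('n \<Rightarrow> 'a) \<Rightarrow> real" where
  "reward G S A = (\<Sum>i\<in>UNIV. local_reward G i (nbr_view G i S A)) / real CARD('n)"

definition transition ::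
  "('n::finite, 'g, 's, 'a) gmdp \<Rightarrow> ('n \<Rightarrow> 's) \<times> 'g \<Rightarrow> ('n \<Rightarrow> 'a) \<Rightarrow> (('n \<Rightarrow> 's) \<times> 'g) measure" where
  "transition G S A =
     PiM UNIV (\<lambda>i. local_kernel G i (nbr_view G i S A)) \<Otimes>\<^sub>M global_kernel G (snd S)"

section \<open>Policies and the induced process\<close>

text \<open>
  \<open>\<pi> i t\<close> is a kernel from local histories \<open>(S\<^sub>i\<^sup>0, \<dots>, S\<^sub>i\<^sup>t; A\<^sub>i\<^sup>0, \<dots>, A\<^sub>i\<^sup>t\<^sup>-\<^sup>1)\<close>
  to the actions of agent \<open>i\<close>.
\<close>

type_synonym ('n, 's, 'a) policy = "'n \<Rightarrow> nat \<Rightarrow> (nat \<Rightarrow> 's) \<times> (nat \<Rightarrow> 'a) \<Rightarrow> 'a measure"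

definition hist_space :: "('n, 'g, 's, 'a) gmdp \<Rightarrow> 'n \<Rightarrow> nat \<Rightarrow> ((nat \<Rightarrow> 's) \<times> (nat \<Rightarrow> 'a)) measure" where
  "hist_space G i t =
     PiM {0..t} (\<lambda>_. local_space G i) \<Otimes>\<^sub>M PiM {0..<t} (\<lambda>_. action_space G i)"

definition is_policy :: "('n::finite, 'g, 's, 'a) gmdp \<Rightarrow> ('n, 's, 'a) policy \<Rightarrow> bool" where
  "is_policy G \<pi> \<longleftrightarrow> (\<forall>i t. \<pi> i t \<in> hist_space G i t \<rightarrow>\<^sub>M prob_algebra (action_space G i))"

text \<open>
  A trajectory is a sequence \<open>\<omega>\<close> with \<open>\<omega> t = (S\<^sup>t, A\<^sup>t)\<close>. In the next two definitions,
  \<open>h\<close> holds the pairs at times \<open>0, \<dots>, t - 1\<close>, and \<open>S\<close> is the state at time \<open>t\<close>.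
\<close>

definition steps :: "('n, 'g, 's, 'a) gmdp \<Rightarrow> ((('n \<Rightarrow> 's) \<times> 'g) \<times> ('n \<Rightarrow> 'a)) measure" where
  "steps G = states G \<Otimes>\<^sub>M actions G"

definition local_hist ::
  "nat \<Rightarrow> (nat \<Rightarrow> (('n \<Rightarrow> 's) \<times> 'g) \<times> ('n \<Rightarrow> 'a)) \<Rightarrow> ('n \<Rightarrow> 's) \<times> 'g \<Rightarrow> 'n \<Rightarrow> (nat \<Rightarrow> 's) \<times> (nat \<Rightarrow> 'a)" where
  "local_hist t h S i =
     ((\<lambda>k\<in>{0..t}. if k = t then fst S i else fst (fst (h k)) i), (\<lambda>k\<in>{0..<t}. snd (h k) i))"

definition action_law ::
  "('n::finite, 's, 'a) policy \<Rightarrow> nat \<Rightarrow> (nat \<Rightarrow> (('n \<Rightarrow> 's) \<times> 'g) \<times> ('n \<Rightarrow> 'a)) \<Rightarrow>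
    ('n \<Rightarrow> 's) \<times> 'g \<Rightarrow> ('n \<Rightarrow> 'a) measure" where
  "action_law \<pi> t h S = PiM UNIV (\<lambda>i. \<pi> i t (local_hist t h S i))"

text \<open>
  The conditional law of \<open>(S\<^sup>t, A\<^sup>t)\<close> given the past, for the process started in \<open>S\<^sup>0 = S\<close>.
\<close>

definition step_law ::
  "('n::finite, 'g, 's, 'a) gmdp \<Rightarrow> ('n, 's, 'a) policy \<Rightarrow> ('n \<Rightarrow> 's) \<times> 'g \<Rightarrow> nat \<Rightarrow>
    (nat \<Rightarrow> (('n \<Rightarrow> 's) \<times> 'g) \<times> ('n \<Rightarrow> 'a)) \<Rightarrow> ((('n \<Rightarrow> 's) \<times> 'g) \<times> ('n \<Rightarrow> 'a)) measure" where
  "step_law G \<pi> S t h =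
     (if t = 0 then return (states G) S else transition G (fst (h (t - 1))) (snd (h (t - 1))))
       \<bind> (\<lambda>S'. distr (action_law \<pi> t h S') (steps G) (Pair S'))"

text \<open>
  The law of the whole trajectory given \<open>S\<^sup>0 = S\<close>: the Ionescu-Tulcea extension of the kernels
  \<^const>\<open>step_law\<close>. Expectation under it is \<open>\<bbbE>\<^sub>\<pi>[ \<cdot> | S\<^sup>0 = S]\<close>.
\<close>

definition trajectory_law ::
  "('n::finite, 'g, 's, 'a) gmdp \<Rightarrow> ('n, 's, 'a) policy \<Rightarrow> ('n \<Rightarrow> 's) \<times> 'g \<Rightarrow>
    (nat \<Rightarrow> (('n \<Rightarrow> 's) \<times> 'g) \<times> ('n \<Rightarrow> 'a)) measure" where
  "trajectory_law G \<pi> S =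
     projective_family.lim UNIV (Ionescu_Tulcea.CI (step_law G \<pi> S) (\<lambda>_. steps G)) (\<lambda>_. steps G)"

definition reward_vec ::
  "('n::finite, 'g, 's, 'a) gmdp \<Rightarrow> nat \<Rightarrow> (nat \<Rightarrow> (('n \<Rightarrow> 's) \<times> 'g) \<times> ('n \<Rightarrow> 'a)) \<Rightarrow> real ^ 'n" where
  "reward_vec G t \<omega> = (\<chi> i. local_reward G i (nbr_view G i (fst (\<omega> t)) (snd (\<omega> t))))"

section \<open>The diffusion value function\<close>

definition adjacency :: "('n::finite, 'g, 's, 'a) gmdp \<Rightarrow> real ^ 'n ^ 'n" where
  "adjacency G = (\<chi> i j. if (i, j) \<in> edges G then 1 else 0)"

definition in_degree :: "('n::finite, 'g, 's, 'a) gmdp \<Rightarrow> real ^ 'n ^ 'n" where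
  "in_degree G = (\<chi> i j. if i = j then \<Sum>k\<in>UNIV. adjacency G $ k $ i else 0)"

definition diffusion :: "('n::finite, 'g, 's, 'a) gmdp \<Rightarrow> real \<Rightarrow> real ^ 'n ^ 'n" where
  "diffusion G \<gamma> = \<gamma> *\<^sub>R (adjacency G ** matrix_inv (in_degree G))"

text \<open>The operation \<open>^\<close> on \<^typ>\<open>real ^ 'n ^ 'n\<close> is the entrywise power, hence:\<close>

primrec matpow :: "real ^ 'n ^ 'n::finite \<Rightarrow> nat \<Rightarrow> real ^ 'n ^ 'n" where
  "matpow M 0 = mat 1"
| "matpow M (Suc k) = M ** matpow M k"

definition diffusion_value ::
  "('n::finite, 'g, 's, 'a) gmdp \<Rightarrow> ('n, 's, 'a) policy \<Rightarrow> real \<Rightarrow> ('n \<Rightarrow> 's) \<times> 'g \<Rightarrow> real ^ 'n" where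
  "diffusion_value G \<pi> \<gamma> S =
     (\<integral>\<omega>. (\<Sum>t. matpow (diffusion G \<gamma>) (t + 1) *v reward_vec G t \<omega>) \<partial>trajectory_law G \<pi> S)"

section \<open>The process is well defined\<close>

lemma PiM_kernel_measurable:
  fixes K :: "'i::finite \<Rightarrow> 'x \<Rightarrow> 'y measure"
  assumes K: "\<And>i. K i \<in> X \<rightarrow>\<^sub>M prob_algebra (M i)"
  shows "(\<lambda>x. PiM UNIV (\<lambda>i. K i x)) \<in> X \<rightarrow>\<^sub>M prob_algebra (PiM UNIV M)"
proof -
  have s: "sets (K i x) = sets (M i)" and p: "prob_space (K i x)" if "x \<in> space X" for i x
    using measurable_space[OF K that] by (auto simp: space_prob_algebra)
  show ?thesis
  proof (rule measurable_prob_algebra_generated[OF sets_PiM Int_stable_prod_algebra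
        prod_algebra_sets_into_space])
    fix x assume x: "x \<in> space X"
    show "prob_space (PiM UNIV (\<lambda>i. K i x))"
      by (rule prob_space_PiM) (rule p[OF x])
    show "sets (PiM UNIV (\<lambda>i. K i x)) = sets (PiM UNIV M)"
      by (rule sets_PiM_cong) (auto simp: s[OF x])
  next
    fix A assume "A \<in> prod_algebra UNIV M"
    then obtain F where A: "A = Pi\<^sub>E UNIV F" and F: "\<And>i. F i \<in> sets (M i)"
      unfolding prod_algebra_eq_finite[OF finite] by auto
    have "emeasure (PiM UNIV (\<lambda>i. K i x)) A = (\<Prod>i\<in>UNIV. emeasure (K i x) (F i))"
      if x: "x \<in> space X" for x
    proof -
      define L where "L = (\<lambda>i. K i x)"
      interpret product_prob_space L UNIV
        by (rule product_prob_spaceI) (simp add: L_def p[OF x])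
      interpret finite_product_prob_space L UNIV by standard simp
      show ?thesis
        using emeasure_PiM[of UNIV F] F by (simp add: A L_def s[OF x])
    qed
    moreover have "(\<lambda>x. \<Prod>i\<in>UNIV. emeasure (K i x) (F i)) \<in> borel_measurable X"
      by (intro borel_measurable_prod_ennreal measurable_emeasure_kernel[OF
            measurable_prob_algebraD[OF K]] F)
    ultimately show "(\<lambda>x. emeasure (PiM UNIV (\<lambda>i. K i x)) A) \<in> borel_measurable X"
      by (simp cong: measurable_cong)
  qed
qed

lemma nbr_view_measurable [measurable]:
  assumes [measurable]: "f \<in> X \<rightarrow>\<^sub>M states G" "g \<in> X \<rightarrow>\<^sub>M actions G"
  shows "(\<lambda>x. nbr_view G i (f x) (g x)) \<in> X \<rightarrow>\<^sub>M nbr_space G i"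
proof -
  have [measurable]: "(\<lambda>x. fst (f x)) \<in> X \<rightarrow>\<^sub>M PiM UNIV (local_space G)"
      "(\<lambda>x. snd (f x)) \<in> X \<rightarrow>\<^sub>M global_space G"
    using assms(1) unfolding states_def by simp_all
  have [measurable]: "g \<in> X \<rightarrow>\<^sub>M PiM UNIV (action_space G)"
    using assms(2) by (simp add: actions_def)
  have "(\<lambda>x. restrict (fst (f x)) (in_nbrs G i)) \<in> X \<rightarrow>\<^sub>M PiM (in_nbrs G i) (local_space G)"
       "(\<lambda>x. restrict (g x) (in_nbrs G i)) \<in> X \<rightarrow>\<^sub>M PiM (in_nbrs G i) (action_space G)"
    by (auto intro!: measurable_restrict)
  then show ?thesis
    unfolding nbr_view_def nbr_space_def by measurable
qed

lemma transition_measurable: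
  assumes "is_gmdp G" "f \<in> X \<rightarrow>\<^sub>M states G" "g \<in> X \<rightarrow>\<^sub>M actions G"
  shows "(\<lambda>x. transition G (f x) (g x)) \<in> X \<rightarrow>\<^sub>M prob_algebra (states G)"
  unfolding transition_def states_def
proof (rule measurable_pair_prob)
  show "(\<lambda>x. PiM UNIV (\<lambda>i. local_kernel G i (nbr_view G i (f x) (g x))))
      \<in> X \<rightarrow>\<^sub>M prob_algebra (PiM UNIV (local_space G))"
    using assms by (intro PiM_kernel_measurable measurable_compose[OF nbr_view_measurable])
      (auto simp: is_gmdp_def)
  have "(\<lambda>x. snd (f x)) \<in> X \<rightarrow>\<^sub>M global_space G"
    using assms(2) unfolding states_def by simp
  then show "(\<lambda>x. global_kernel G (snd (f x))) \<in> X \<rightarrow>\<^sub>M prob_algebra (global_space G)"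
    using assms(1) by (auto simp: is_gmdp_def intro: measurable_compose)
qed

lemma step_law_measurable:
  fixes G :: "('n::finite, 'g, 's, 'a) gmdp"
  assumes "is_gmdp G" "is_policy G \<pi>" "S \<in> space (states G)"
  shows "step_law G \<pi> S t \<in> PiM {0..<t} (\<lambda>_. steps G) \<rightarrow>\<^sub>M prob_algebra (steps G)"
proof -
  let ?H = "PiM {0..<t} (\<lambda>_. steps G)"
  have comp: "(\<lambda>h. h k) \<in> ?H \<rightarrow>\<^sub>M states G \<Otimes>\<^sub>M actions G" if "k < t" for k
    using that measurable_component_singleton[of k "{0..<t}" "\<lambda>_. steps G"]
    by (simp add: steps_def)
  have fstc: "(\<lambda>h. fst (h k)) \<in> ?H \<rightarrow>\<^sub>M states G" and sndc: "(\<lambda>h. snd (h k)) \<in> ?H \<rightarrow>\<^sub>M actions G"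
    if "k < t" for k
    using measurable_compose[OF comp[OF that] measurable_fst]
      measurable_compose[OF comp[OF that] measurable_snd] by simp_all
  have loc: "(\<lambda>S. fst S i) \<in> states G \<rightarrow>\<^sub>M local_space G i" for i
    unfolding states_def by measurable
  have act: "(\<lambda>A. A i) \<in> actions G \<rightarrow>\<^sub>M action_space G i" for i
    unfolding actions_def by measurable
  have hist: "(\<lambda>x. local_hist t (fst x) (snd x) i) \<in> ?H \<Otimes>\<^sub>M states G \<rightarrow>\<^sub>M hist_space G i t" for i
    unfolding local_hist_def hist_space_def
  proof (intro measurable_Pair measurable_restrict)
    fix k assume k: "k \<in> {0..t}"
    show "(\<lambda>x. if k = t then fst (snd x) i else fst (fst (fst x k)) i)
        \<in> ?H \<Otimes>\<^sub>M states G \<rightarrow>\<^sub>M local_space G i"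
    proof (cases "k = t")
      case True
      then show ?thesis using measurable_compose[OF measurable_snd loc] by simp
    next
      case False
      with k have "k < t" by auto
      then show ?thesis
        using False measurable_compose[OF measurable_fst measurable_compose[OF fstc loc]] by simp
    qed
  next
    fix k assume "k \<in> {0..<t}"
    then show "(\<lambda>x. snd (fst x k) i) \<in> ?H \<Otimes>\<^sub>M states G \<rightarrow>\<^sub>M action_space G i"
      using measurable_compose[OF measurable_fst measurable_compose[OF sndc act]] by simp
  qed
  have law: "(\<lambda>x. action_law \<pi> t (fst x) (snd x)) \<in> ?H \<Otimes>\<^sub>M states G \<rightarrow>\<^sub>M prob_algebra (actions G)"
    unfolding action_law_def actions_def using assms(2)
    by (intro PiM_kernel_measurable measurable_compose[OF hist]) (auto simp: is_policy_def)
  have "(\<lambda>x. distr (action_law \<pi> t (fst x) (snd x)) (steps G) (Pair (snd x)))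
      \<in> ?H \<Otimes>\<^sub>M states G \<rightarrow>\<^sub>M prob_algebra (steps G)"
    by (rule measurable_distr_prob_space2[OF law]) (simp add: steps_def split_beta')
  moreover have "(\<lambda>h. if t = 0 then return (states G) S
        else transition G (fst (h (t - 1))) (snd (h (t - 1)))) \<in> ?H \<rightarrow>\<^sub>M prob_algebra (states G)"
  proof (cases "t = 0")
    case True
    have "return (states G) S \<in> space (prob_algebra (states G))"
      using assms(3) by (auto simp: space_prob_algebra prob_space_return)
    with True show ?thesis by simp
  next
    case False
    then show ?thesis
      using transition_measurable[OF assms(1) fstc sndc, of "t - 1" "t - 1"] by simp
  qed
  ultimately show ?thesis
    unfolding step_law_def
    by (intro measurable_bind_prob_space2[where N = "states G"]) (simp_all add: split_beta')
qed

lemma Ionescu_Tulcea_step_law: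
  assumes "is_gmdp G" "is_policy G \<pi>" "S \<in> space (states G)"
  shows "Ionescu_Tulcea (step_law G \<pi> S) (\<lambda>_. steps G)"
proof (rule Ionescu_Tulcea.intro)
  show "step_law G \<pi> S i \<in> PiM {0..<i} (\<lambda>_. steps G) \<rightarrow>\<^sub>M subprob_algebra (steps G)" for i
    by (rule measurable_prob_algebraD[OF step_law_measurable[OF assms]])
  fix i :: nat and x assume "x \<in> space (PiM {0..<i} (\<lambda>_. steps G))"
  then show "prob_space (step_law G \<pi> S i x)"
    using measurable_space[OF step_law_measurable[OF assms]] by (simp add: space_prob_algebra)
qed

lemma
  assumes "is_gmdp G" "is_policy G \<pi>" "S \<in> space (states G)"
  shows prob_space_trajectory_law: "prob_space (trajectory_law G \<pi> S)"
    and sets_trajectory_law: "sets (trajectory_law G \<pi> S) = sets (PiM UNIV (\<lambda>_. steps G))"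
proof -
  interpret Ionescu_Tulcea "step_law G \<pi> S" "\<lambda>_. steps G"
    by (rule Ionescu_Tulcea_step_law[OF assms])
  show "sets (trajectory_law G \<pi> S) = sets (PiM UNIV (\<lambda>_. steps G))"
    unfolding trajectory_law_def by (rule PF.sets_lim)
  have "prob_space (distr (trajectory_law G \<pi> S) (PiM {} (\<lambda>_. steps G)) (\<lambda>x. restrict x {}))"
    unfolding trajectory_law_def using distr_lim[of "{}"] PF.prob_space_P[of "{}"] by simp
  then show "prob_space (trajectory_law G \<pi> S)"
  proof (rule prob_space_distrD[rotated])
    show "(\<lambda>x. restrict x {}) \<in> trajectory_law G \<pi> S \<rightarrow>\<^sub>M PiM {} (\<lambda>_. steps G)"
      by (rule measurable_restrict) simp
  qed
qed

end

theory Submission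
  imports Defs
begin

text \<open>
  The column sums of \<open>\<bbbA> D\<^sup>-\<^sup>1\<close> are \<open>1\<close>, so \<open>\<Gamma>\<close> contracts the
  \<open>\<ell>\<^sup>1\<close>-norm by the factor \<open>\<gamma>\<close>. Hence the \<open>t\<close>-th term of the series is bounded by
  \<open>\<gamma>\<^sup>t\<^sup>+\<^sup>1 n B\<close> along every trajectory, where \<open>B\<close> bounds the local rewards. Dominated
  convergence then allows summing under the expectation.
\<close>

text \<open>The self-loop contributes 1 and no summand is negative. This makes the degree matrix
  invertible.\<close>

lemma in_degree_pos:
  assumes "(i, i) \<in> edges G"
  shows "0 < (\<Sum>k\<in>UNIV. adjacency G $ k $ i)"
proof -
  have "0 < adjacency G $ i $ i" using assms by (simp add: adjacency_def)
  also have "\<dots> \<le> (\<Sum>k\<in>UNIV. adjacency G $ k $ i)"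
    by (rule member_le_sum) (auto simp: adjacency_def)
  finally show ?thesis .
qed

text \<open>\<open>matrix_inv\<close> is a Hilbert choice among two-sided inverses, so identifying
  it with a known inverse takes the usual uniqueness argument.\<close>

lemma matrix_inv_unique:
  fixes A :: "'a::semiring_1 ^ 'n::finite ^ 'm::finite"
  assumes "A ** B = mat 1" and "B ** A = mat 1"
  shows "matrix_inv A = B"
  unfolding matrix_inv_def
proof (rule some_equality)
  fix C assume C: "A ** C = mat 1 \<and> C ** A = mat 1"
  have "C = C ** (A ** B)" by (simp add: assms(1))
  also have "\<dots> = (C ** A) ** B" by (simp add: matrix_mul_assoc)
  finally show "C = B" using C by simp
qed (simp add: assms)

lemma matrix_mult_diagonal:
  fixes A :: "'a::semiring_1 ^ 'n::finite ^ 'm::finite"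
  shows "A ** (\<chi> i j. if i = j then d i else 0) = (\<chi> i j. A $ i $ j * d j)"
proof -
  have "(\<Sum>k\<in>UNIV. A $ i $ k * (if k = j then d k else 0)) =
      (\<Sum>k\<in>UNIV. if k = j then A $ i $ k * d k else 0)" for i j
    by (rule sum.cong) simp_all
  then show ?thesis by (simp add: matrix_matrix_mult_def)
qed

lemma matrix_inv_diagonal:
  fixes d :: "'n::finite \<Rightarrow> 'a::field"
  assumes "\<And>i. d i \<noteq> 0"
  shows "matrix_inv (\<chi> i j. if i = j then d i else 0) = (\<chi> i j. if i = j then inverse (d i) else 0)"
  by (rule matrix_inv_unique) (simp_all add: matrix_mult_diagonal mat_def vec_eq_iff assms)

text \<open>Right multiplication by the inverse degree matrix divides column \<open>j\<close> by the
  in-degree of \<open>j\<close>, which is the sum of that same column of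
  \<open>adjacency G\<close>.\<close>

lemma diffusion_nth:
  assumes "\<And>i. (i, i) \<in> edges G"
  shows "diffusion G \<gamma> $ i $ j = \<gamma> * (adjacency G $ i $ j / (\<Sum>k\<in>UNIV. adjacency G $ k $ j))"
proof -
  have "(\<Sum>k\<in>UNIV. adjacency G $ k $ i) \<noteq> 0" for i
    using in_degree_pos[OF assms, of i] by simp
  from matrix_inv_diagonal[where d = "\<lambda>i. \<Sum>k\<in>UNIV. adjacency G $ k $ i", OF this]
  show ?thesis
    by (simp add: diffusion_def in_degree_def matrix_mult_diagonal divide_inverse)
qed

text \<open>Adjacency entries are nonnegative, so the absolute value falls on \<gamma> alone; the
  rest of the column is normalised by its own sum.\<close>

lemma diffusion_column_sum:
  assumes "\<And>i. (i, i) \<in> edges G"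
  shows "(\<Sum>i\<in>UNIV. \<bar>diffusion G \<gamma> $ i $ j\<bar>) = \<bar>\<gamma>\<bar>"
proof -
  have pos: "0 < (\<Sum>k\<in>UNIV. adjacency G $ k $ j)"
    using in_degree_pos[OF assms] .
  have "\<bar>diffusion G \<gamma> $ i $ j\<bar> =
      \<bar>\<gamma>\<bar> * (adjacency G $ i $ j / (\<Sum>k\<in>UNIV. adjacency G $ k $ j))" for i
  proof -
    have "0 \<le> adjacency G $ i $ j"
      by (simp add: adjacency_def)
    with pos show ?thesis
      by (simp only: diffusion_nth[OF assms] abs_mult abs_divide abs_of_pos abs_of_nonneg)
  qed
  with pos show ?thesis
    by (simp add: sum_distrib_left[symmetric] sum_divide_distrib[symmetric])
qed

text \<open>Exchanging the two sums weights each \<open>\<bar>x $ j\<bar>\<close> by the absolute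
  sum of column \<open>j\<close>.\<close>

lemma l1_matrix_vector_mult_le:
  fixes M :: "real ^ 'n::finite ^ 'm::finite"
  assumes "\<And>j. (\<Sum>i\<in>UNIV. \<bar>M $ i $ j\<bar>) \<le> c"
  shows "(\<Sum>i\<in>UNIV. \<bar>(M *v x) $ i\<bar>) \<le> c * (\<Sum>j\<in>UNIV. \<bar>x $ j\<bar>)"
proof -
  have "(\<Sum>i\<in>UNIV. \<bar>(M *v x) $ i\<bar>) \<le> (\<Sum>i\<in>UNIV. \<Sum>j\<in>UNIV. \<bar>M $ i $ j\<bar> * \<bar>x $ j\<bar>)"
    unfolding matrix_vector_mult_def by (auto intro!: sum_mono order.trans[OF sum_abs] simp: abs_mult)
  also have "\<dots> = (\<Sum>j\<in>UNIV. (\<Sum>i\<in>UNIV. \<bar>M $ i $ j\<bar>) * \<bar>x $ j\<bar>)"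
    by (subst sum.swap) (simp add: sum_distrib_right)
  also have "\<dots> \<le> (\<Sum>j\<in>UNIV. c * \<bar>x $ j\<bar>)"
    by (intro sum_mono mult_right_mono assms) simp
  finally show ?thesis by (simp add: sum_distrib_left)
qed

text \<open>Iterating in the l1 norm keeps the rate \<open>c\<close>; the Euclidean operator norm of
  a column-stochastic matrix can exceed 1.\<close>

lemma l1_matpow_le:
  fixes M :: "real ^ 'n::finite ^ 'n"
  assumes "\<And>j. (\<Sum>i\<in>UNIV. \<bar>M $ i $ j\<bar>) \<le> c" and "0 \<le> c"
  shows "(\<Sum>i\<in>UNIV. \<bar>(matpow M k *v x) $ i\<bar>) \<le> c ^ k * (\<Sum>j\<in>UNIV. \<bar>x $ j\<bar>)"
proof (induction k)
  case (Suc k)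
  have "(\<Sum>i\<in>UNIV. \<bar>(matpow M (Suc k) *v x) $ i\<bar>)
      \<le> c * (\<Sum>i\<in>UNIV. \<bar>(matpow M k *v x) $ i\<bar>)"
    using l1_matrix_vector_mult_le[OF assms(1)] by (simp flip: matrix_vector_mul_assoc)
  also have "\<dots> \<le> c * (c ^ k * (\<Sum>j\<in>UNIV. \<bar>x $ j\<bar>))"
    by (rule mult_left_mono[OF Suc assms(2)])
  finally show ?case by (simp add: mult.assoc)
qed simp

text \<open>The passage from the Euclidean to the l1 norm happens once, after all \<open>k\<close>
  multiplications, so the factor \<open>CARD('n)\<close> does not grow with
  \<open>k\<close>.\<close>

lemma norm_diffusion_term_le:
  fixes x :: "real ^ 'n::finite"
  assumes "\<And>i. (i, i) \<in> edges G" and "0 \<le> \<gamma>" and "\<And>i. \<bar>x $ i\<bar> \<le> B"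
  shows "norm (matpow (diffusion G \<gamma>) k *v x) \<le> \<gamma> ^ k * (real CARD('n) * B)"
proof -
  have "norm (matpow (diffusion G \<gamma>) k *v x) \<le> \<gamma> ^ k * (\<Sum>j\<in>UNIV. \<bar>x $ j\<bar>)"
    by (rule order.trans[OF norm_le_l1_cart l1_matpow_le])
      (use assms(2) in \<open>simp_all add: diffusion_column_sum[OF assms(1)]\<close>)
  also have "\<dots> \<le> \<gamma> ^ k * (real CARD('n) * B)"
    by (intro mult_left_mono sum_bounded_above assms(3) zero_le_power assms(2))
  finally show ?thesis .
qed

lemma measurable_trajectory_component:
  assumes "is_gmdp G" "is_policy G \<pi>" "S \<in> space (states G)"
  shows "(\<lambda>\<omega>. \<omega> t) \<in> trajectory_law G \<pi> S \<rightarrow>\<^sub>M states G \<Otimes>\<^sub>M actions G"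
  by (subst measurable_cong_sets[OF sets_trajectory_law[OF assms] refl])
    (simp flip: steps_def)

text \<open>Besides measurability of rewards, this yields that local views along a trajectory lie in
  \<open>nbr_space G i\<close>, where the bound on rewards applies.\<close>

lemma measurable_trajectory_nbr_view:
  assumes "is_gmdp G" "is_policy G \<pi>" "S \<in> space (states G)"
  shows "(\<lambda>\<omega>. nbr_view G i (fst (\<omega> t)) (snd (\<omega> t))) \<in> trajectory_law G \<pi> S \<rightarrow>\<^sub>M nbr_space G i"
  using measurable_compose[OF measurable_trajectory_component[OF assms] measurable_fst]
    measurable_compose[OF measurable_trajectory_component[OF assms] measurable_snd]
  by (rule nbr_view_measurable)

lemma borel_measurable_vec_lambda:
  fixes f :: "'n::finite \<Rightarrow> 'x \<Rightarrow> real"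
  assumes "\<And>i. f i \<in> borel_measurable M"
  shows "(\<lambda>x. \<chi> i. f i x) \<in> borel_measurable M"
  using assms
  by (subst borel_measurable_euclidean_space) (auto simp: Basis_vec_def inner_axis)

lemma reward_vec_measurable:
  assumes "is_gmdp G" "is_policy G \<pi>" "S \<in> space (states G)"
  shows "reward_vec G t \<in> borel_measurable (trajectory_law G \<pi> S)"
  unfolding reward_vec_def using assms(1)
  by (intro borel_measurable_vec_lambda measurable_compose[OF measurable_trajectory_nbr_view[OF assms]])
    (auto simp: is_gmdp_def)

text \<open>Almost sure summability makes the inner \<open>suminf\<close> a genuine limit, and
  integrability keeps the Bochner integral from defaulting to 0. The \<open>sums\<close> clause is
  convergence of the series of expected terms to the same value.\<close>

theorem proposition3p1:
  fixes G :: "('n::finite, 'g, 's, 'a) gmdp"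
    and \<pi> :: "('n, 's, 'a) policy"
    and \<gamma> :: real
  assumes "is_gmdp G"
    and "is_policy G \<pi>"
    and "\<And>i. bounded (local_reward G i ` space (nbr_space G i))"
    and "\<gamma> \<in> {0<..<1}"
  shows "(\<forall>S\<in>space (states G).
           (AE \<omega> in trajectory_law G \<pi> S.
              summable (\<lambda>t. matpow (diffusion G \<gamma>) (t + 1) *v reward_vec G t \<omega>)) \<and>
           integrable (trajectory_law G \<pi> S)
              (\<lambda>\<omega>. \<Sum>t. matpow (diffusion G \<gamma>) (t + 1) *v reward_vec G t \<omega>) \<and>
           (\<lambda>t. matpow (diffusion G \<gamma>) (t + 1) *v
                  (\<integral>\<omega>. reward_vec G t \<omega> \<partial>trajectory_law G \<pi> S))
              sums diffusion_value G \<pi> \<gamma> S)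
       \<and> bounded (diffusion_value G \<pi> \<gamma> ` space (states G))"
proof -
  have edges: "(i, i) \<in> edges G" for i
    using assms(1) by (simp add: is_gmdp_def)
  have \<gamma>: "0 \<le> \<gamma>" "norm \<gamma> < 1"
    using assms(4) by auto
  \<comment> \<open>There are finitely many agents, so one bound \<open>B\<close> serves all of
    them.\<close>
  have "bounded (\<Union>i. local_reward G i ` space (nbr_space G i))"
    using assms(3) by (intro bounded_UN) simp_all
  then obtain B where B: "\<bar>local_reward G i v\<bar> \<le> B" if "v \<in> space (nbr_space G i)" for i v
    unfolding bounded_iff by auto
  \<comment> \<open>A geometric majorant independent of trajectory and initial state. The exponent
    is \<open>t + 1\<close> because the reward at time 0 is already diffused once.\<close>
  define b where "b t = \<gamma> ^ (t + 1) * (real CARD('n) * B)" for t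
  have b: "summable b"
    unfolding b_def using \<gamma>(2) by (intro summable_mult2) (simp add: summable_geometric)
  define X where "X t \<omega> = matpow (diffusion G \<gamma>) (t + 1) *v reward_vec G t \<omega>" for t \<omega>
  \<comment> \<open>The added last conjunct bounds the value by a number free of \<open>S\<close>,
    which gives boundedness over all states.\<close>
  have main: "(AE \<omega> in trajectory_law G \<pi> S. summable (\<lambda>t. X t \<omega>)) \<and>
      integrable (trajectory_law G \<pi> S) (\<lambda>\<omega>. \<Sum>t. X t \<omega>) \<and>
      (\<lambda>t. matpow (diffusion G \<gamma>) (t + 1) *v (\<integral>\<omega>. reward_vec G t \<omega> \<partial>trajectory_law G \<pi> S))
        sums diffusion_value G \<pi> \<gamma> S \<and>
      norm (diffusion_value G \<pi> \<gamma> S) \<le> suminf b"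
    if S: "S \<in> space (states G)" for S
  proof -
    let ?P = "trajectory_law G \<pi> S"
    interpret prob_space ?P
      by (rule prob_space_trajectory_law[OF assms(1,2) S])
    have R: "\<bar>reward_vec G t \<omega> $ i\<bar> \<le> B" if "\<omega> \<in> space ?P" for t i \<omega>
      using B measurable_space[OF measurable_trajectory_nbr_view[OF assms(1,2) S] that]
      by (simp add: reward_vec_def)
    have Xb: "norm (X t \<omega>) \<le> b t" if "\<omega> \<in> space ?P" for t \<omega>
      unfolding X_def b_def by (rule norm_diffusion_term_le[OF edges \<gamma>(1) R[OF that]])
    have intR: "integrable ?P (reward_vec G t)" for t
    proof (rule integrable_const_bound[where B = "real CARD('n) * B"])
      show "AE \<omega> in ?P. norm (reward_vec G t \<omega>) \<le> real CARD('n) * B"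
        using R by (intro AE_I2 order.trans[OF norm_le_l1_cart] sum_bounded_above)
    qed (rule reward_vec_measurable[OF assms(1,2) S])
    \<comment> \<open>Multiplication by a fixed matrix is bounded linear, so it commutes with the
      expectation.\<close>
    have X: "integrable ?P (X t)"
      "integral\<^sup>L ?P (X t) = matpow (diffusion G \<gamma>) (t + 1) *v integral\<^sup>L ?P (reward_vec G t)" for t
      unfolding X_def
      using integrable_bounded_linear[OF matrix_vector_mul_bounded_linear intR]
        integral_bounded_linear[OF matrix_vector_mul_bounded_linear intR] by auto
    have sX: "summable (\<lambda>t. norm (X t \<omega>))" if "\<omega> \<in> space ?P" for \<omega>
      by (rule summable_comparison_test'[OF b]) (simp add: Xb[OF that])
    \<comment> \<open>The law has total mass 1, so the pointwise bound survives integration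
      unchanged.\<close>
    have iX: "(\<integral>\<omega>. norm (X t \<omega>) \<partial>?P) \<le> b t" for t
      using Xb by (intro integral_le_const integrable_norm X AE_I2)
    have siX: "summable (\<lambda>t. \<integral>\<omega>. norm (X t \<omega>) \<partial>?P)"
      by (rule summable_comparison_test'[OF b]) (simp add: iX integral_nonneg)
    have val: "diffusion_value G \<pi> \<gamma> S = (\<integral>\<omega>. (\<Sum>t. X t \<omega>) \<partial>?P)"
      by (simp add: diffusion_value_def X_def)
    have AEs: "AE \<omega> in ?P. summable (\<lambda>t. norm (X t \<omega>))"
      using sX by (rule AE_I2)
    \<comment> \<open>Sum and expectation are exchanged, using absolute summability along
      trajectories and summability of the expected norms.\<close>
    have sums: "(\<lambda>t. integral\<^sup>L ?P (X t)) sums diffusion_value G \<pi> \<gamma> S"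
      unfolding val by (rule sums_integral[OF X(1) AEs siX])
    have "norm (integral\<^sup>L ?P (X t)) \<le> b t" for t
      using integral_norm_bound iX by (rule order.trans)
    then have "norm (diffusion_value G \<pi> \<gamma> S) \<le> suminf b"
      unfolding sums_unique[OF sums] by (rule norm_suminf_le[OF _ b])
    moreover have "AE \<omega> in ?P. summable (\<lambda>t. X t \<omega>)"
      using AEs by eventually_elim (rule summable_norm_cancel)
    moreover have "integrable ?P (\<lambda>\<omega>. \<Sum>t. X t \<omega>)"
      by (rule integrable_suminf[OF X(1) AEs siX])
    ultimately show ?thesis
      using sums by (simp add: X(2))
  qed
  then show ?thesis
    unfolding X_def by (auto intro!: boundedI)
qed

end
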